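(* Let $A$, the iterates $u_k$, the matrices $J_k$ and the errors $e_k$ be as in the context. There exist a positive number $\delta$ and a constant $c_1$ such that if $\|e_k\|<\delta$ then $$\|J_{k+1}-J_k\|\le c_1\|e_k\|.$$
   Context: $A\in\mathbb{R}^{n\times n}$ is symmetric positive definite with eigenvalues $\lambda_1<\lambda_2<\dots<\lambda_n$ and unit eigenvector $v_1$ for $\lambda_1$. Vector norms are Euclidean and the norm of a symmetric matrix is the spectral norm. Newton iteration: $u_0$ is a unit vector; for $k\ge 0$, $\theta_k=u_k^\top A u_k$, $$J_k=(I-u_ku_k^\top)(A-\theta_k I)(I-u_ku_k^\top),$$ $s_k$ is an (exact or approximate) solution, lying in the subspace orthogonal to $u_k$, of the correction equation $J_ks_k=-(Au_k-\theta_ku_k)$, and $u_{k+1}=(u_k+s_k)/\|u_k+s_k\|$. Set $e_k=u_k-v_1$. Standing assumption: convergence holds, i.e. there is a constant $r<1$ with $\|e_{k+1}\|<r\|e_k\|$ for all $k\ge0$. The numbers $\delta$ and $c_1$ do not depend on $k$. *)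

theory Defs
  imports "HOL-Analysis.Analysis"
begin

definition pos_definite :: "real^'n^'n \<Rightarrow> bool" where
  "pos_definite A \<longleftrightarrow> (\<forall>x. x \<noteq> 0 \<longrightarrow> x \<bullet> (A *v x) > 0)"

definition eigenvalue_of :: "real^'n^'n \<Rightarrow> real \<Rightarrow> bool" where
  "eigenvalue_of A l \<longleftrightarrow> (\<exists>v. v \<noteq> 0 \<and> A *v v = l *\<^sub>R v)"

text \<open>The norm of the type \<^typ>\<open>real^'n^'n\<close> is the Frobenius norm, hence a separate
  definition of the spectral norm.\<close>

definition spectral_norm :: "real^'n^'n \<Rightarrow> real" where
  "spectral_norm M = onorm (\<lambda>x. M *v x)"

text \<open>The matrix \<open>I - u u\<^sup>T\<close>.\<close>

definition perp_proj :: "real^'n \<Rightarrow> real^'n^'n" where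
  "perp_proj u = mat 1 - (\<chi> i j. u $ i * u $ j)"

definition rayleigh :: "real^'n^'n \<Rightarrow> real^'n \<Rightarrow> real" where
  "rayleigh A u = u \<bullet> (A *v u)"

definition newton_J :: "real^'n^'n \<Rightarrow> real^'n \<Rightarrow> real^'n^'n" where
  "newton_J A u = perp_proj u ** (A - rayleigh A u *\<^sub>R mat 1) ** perp_proj u"

text \<open>The vector \<open>res k\<close> is the residual with which \<open>s k\<close> solves the correction equation:
  \<open>res k = 0\<close> is an exact solve; an approximate solve has an arbitrary residual, since no
  accuracy is prescribed.  The norm in the update is nonzero, as \<open>s k\<close> is orthogonal to the
  unit vector \<open>u k\<close>.\<close>

definition newton_iteration ::
  "real^'n^'n \<Rightarrow> (nat \<Rightarrow> real^'n) \<Rightarrow> (nat \<Rightarrow> real^'n) \<Rightarrow> (nat \<Rightarrow> real^'n) \<Rightarrow> bool" where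
  "newton_iteration A u s res \<longleftrightarrow>
     norm (u 0) = 1 \<and>
     (\<forall>k. s k \<bullet> u k = 0 \<and>
          newton_J A (u k) *v s k = - (A *v u k - rayleigh A (u k) *\<^sub>R u k) + res k \<and>
          u (Suc k) = (1 / norm (u k + s k)) *\<^sub>R (u k + s k))"

end

theory Submission
  imports Defs
begin

text \<open>The map \<open>u \<mapsto> J(u)\<close> is Lipschitz on the unit sphere, since its three factors are bounded
  and Lipschitz there. All iterates are unit vectors, and the contraction of the errors gives
  \<open>\<parallel>u\<^bsub>k+1\<^esub> - u\<^sub>k\<parallel> \<le> \<parallel>e\<^bsub>k+1\<^esub>\<parallel> + \<parallel>e\<^sub>k\<parallel> \<le> 2\<parallel>e\<^sub>k\<parallel>\<close>; hence any \<open>\<delta>\<close> works.\<close>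

lemma spectral_norm_nonneg: "0 \<le> spectral_norm M"
  by (simp add: spectral_norm_def onorm_pos_le matrix_vector_mul_bounded_linear)

lemma norm_matrix_vector_le: "norm (M *v x) \<le> spectral_norm M * norm x"
  by (simp add: spectral_norm_def onorm matrix_vector_mul_bounded_linear)

lemma spectral_norm_le: "(\<And>x. norm (M *v x) \<le> c * norm x) \<Longrightarrow> spectral_norm M \<le> c"
  unfolding spectral_norm_def by (rule onorm_le)

lemma spectral_norm_mult: "spectral_norm (M ** N) \<le> spectral_norm M * spectral_norm N"
proof (rule spectral_norm_le)
  fix x
  have "norm ((M ** N) *v x) \<le> spectral_norm M * norm (N *v x)"
    by (metis matrix_vector_mul_assoc norm_matrix_vector_le)
  also have "\<dots> \<le> spectral_norm M * (spectral_norm N * norm x)"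
    by (intro mult_left_mono norm_matrix_vector_le spectral_norm_nonneg)
  finally show "norm ((M ** N) *v x) \<le> spectral_norm M * spectral_norm N * norm x"
    by (simp add: mult.assoc)
qed

text \<open>Submultiplicativity in a form that chains by \<open>intro\<close>, so that bounds on the
  single factors of a triple product multiply up. The sign condition on \<open>a\<close> comes for
  free, as \<open>a\<close> dominates a norm.\<close>

lemma spectral_norm_mult_le:
  assumes "spectral_norm M \<le> a" and "spectral_norm N \<le> b"
  shows "spectral_norm (M ** N) \<le> a * b"
proof -
  have "0 \<le> a"
    using assms(1) spectral_norm_nonneg order_trans by blast
  then show ?thesis
    using spectral_norm_mult mult_mono[OF assms _ spectral_norm_nonneg] order_trans by blast
qed

lemma spectral_norm_add: "spectral_norm (M + N) \<le> spectral_norm M + spectral_norm N"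
proof (rule spectral_norm_le)
  fix x
  have "norm ((M + N) *v x) \<le> norm (M *v x) + norm (N *v x)"
    by (simp add: matrix_vector_mult_add_rdistrib norm_triangle_ineq)
  also have "\<dots> \<le> (spectral_norm M + spectral_norm N) * norm x"
    by (simp add: distrib_right add_mono norm_matrix_vector_le)
  finally show "norm ((M + N) *v x) \<le> (spectral_norm M + spectral_norm N) * norm x" .
qed

lemma perp_proj_mult_vec: "perp_proj u *v x = x - (u \<bullet> x) *\<^sub>R u"
proof -
  have "(\<chi> i j. u $ i * u $ j) *v x = (u \<bullet> x) *\<^sub>R u"
    by (simp add: vec_eq_iff matrix_vector_mult_def inner_vec_def sum_distrib_left mult_ac)
  then show ?thesis
    by (simp add: perp_proj_def matrix_vector_mult_diff_rdistrib)
qed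

text \<open>The triangle inequality suffices here: the sharp bound for this orthogonal projection is
  1, but only some constant independent of \<open>u\<close> matters.\<close>

lemma spectral_norm_perp_proj:
  assumes "norm u = 1"
  shows "spectral_norm (perp_proj u) \<le> 2"
proof (rule spectral_norm_le)
  fix x
  have "norm (x - (u \<bullet> x) *\<^sub>R u) \<le> norm x + norm ((u \<bullet> x) *\<^sub>R u)"
    by (rule norm_triangle_ineq4)
  also have "\<dots> \<le> 2 * norm x"
    using Cauchy_Schwarz_ineq2[of u x] assms by simp
  finally show "norm (perp_proj u *v x) \<le> 2 * norm x"
    by (simp add: perp_proj_mult_vec)
qed

lemma spectral_norm_perp_proj_diff:
  assumes "norm u = 1" and "norm v = 1"
  shows "spectral_norm (perp_proj u - perp_proj v) \<le> 2 * norm (u - v)"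
proof (rule spectral_norm_le)
  fix x
  \<comment> \<open>Adding and subtracting u v^T splits v v^T - u u^T into (v - u) v^T + u (v -
    u)^T; each rank-one term contains the small vector v - u once.\<close>
  have "(perp_proj u - perp_proj v) *v x = (v \<bullet> x) *\<^sub>R (v - u) + ((v - u) \<bullet> x) *\<^sub>R u"
    by (simp add: perp_proj_mult_vec matrix_vector_mult_diff_rdistrib algebra_simps)
  also have "norm \<dots> \<le> \<bar>v \<bullet> x\<bar> * norm (v - u) + \<bar>(v - u) \<bullet> x\<bar>"
    using assms by (metis mult.right_neutral norm_scaleR norm_triangle_ineq)
  also have "\<dots> \<le> norm x * norm (v - u) + norm (v - u) * norm x"
    using Cauchy_Schwarz_ineq2[of v x] Cauchy_Schwarz_ineq2[of "v - u" x] assms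
    by (intro add_mono mult_right_mono) auto
  finally show "norm ((perp_proj u - perp_proj v) *v x) \<le> 2 * norm (u - v) * norm x"
    by (simp add: norm_minus_commute mult_ac)
qed

lemma bilinear_form_bound: "\<bar>x \<bullet> (A *v y)\<bar> \<le> norm x * (spectral_norm A * norm y)"
  by (meson Cauchy_Schwarz_ineq2 mult_left_mono norm_ge_zero norm_matrix_vector_le order_trans)

lemma rayleigh_diff_le:
  assumes "norm u = 1" and "norm v = 1"
  shows "\<bar>rayleigh A u - rayleigh A v\<bar> \<le> 2 * spectral_norm A * norm (u - v)"
proof -
  \<comment> \<open>Insert the mixed term \<open>v \<bullet> (A *v u)\<close>, so that only one
    argument of the bilinear form changes at a time.\<close>
  have "rayleigh A u - rayleigh A v = (u - v) \<bullet> (A *v u) + v \<bullet> (A *v (u - v))"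
    by (simp add: rayleigh_def matrix_vector_mult_diff_distrib algebra_simps)
  then show ?thesis
    using bilinear_form_bound[of "u - v" A u] bilinear_form_bound[of v A "u - v"] assms
    by (simp add: mult.commute[of "norm (u - v)"])
qed

lemma spectral_norm_scaled_identity: "spectral_norm (c *\<^sub>R mat 1 :: real^'n^'n) \<le> \<bar>c\<bar>"
  by (rule spectral_norm_le) (simp add: scaleR_matrix_vector_assoc[symmetric])

text \<open>On the unit sphere the Rayleigh quotient is at most \<open>spectral_norm A\<close> in
  absolute value, so the shift at most doubles the bound.\<close>

lemma spectral_norm_shift:
  fixes A :: "real^'n^'n"
  assumes "norm u = 1"
  shows "spectral_norm (A - rayleigh A u *\<^sub>R mat 1) \<le> 2 * spectral_norm A"
  using spectral_norm_add[of A "(- rayleigh A u) *\<^sub>R mat 1"]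
    spectral_norm_scaled_identity[where 'n = 'n, of "- rayleigh A u"]
    bilinear_form_bound[of u A u] assms
  by (simp add: rayleigh_def)

lemma matrix_diff_ldistrib: "M ** (N - L) = M ** N - M ** (L :: real^'a^'b)"
  by (simp add: vec_eq_iff matrix_matrix_mult_def right_diff_distrib sum_subtractf)

lemma matrix_diff_rdistrib: "(N - L) ** M = N ** M - L ** (M :: real^'a^'b)"
  by (simp add: vec_eq_iff matrix_matrix_mult_def left_diff_distrib sum_subtractf)

lemma newton_J_lipschitz:
  fixes A :: "real^'n^'n"
  assumes "norm u = 1" and "norm v = 1"
  shows "spectral_norm (newton_J A u - newton_J A v) \<le> 24 * spectral_norm A * norm (u - v)"
proof -
  define N where "N = spectral_norm A"
  define d where "d = norm (u - v)"
  define P where "P = (perp_proj :: real^'n \<Rightarrow> real^'n^'n)"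
  define B where "B = (\<lambda>w. A - rayleigh A w *\<^sub>R mat 1)"
  have P: "spectral_norm (P u) \<le> 2" "spectral_norm (P v) \<le> 2" "spectral_norm (P u - P v) \<le> 2 * d"
    using assms by (auto simp: P_def d_def spectral_norm_perp_proj spectral_norm_perp_proj_diff)
  have B: "spectral_norm (B u) \<le> 2 * N" "spectral_norm (B v) \<le> 2 * N"
    using assms by (auto simp: B_def N_def spectral_norm_shift)
  \<comment> \<open>The matrix \<open>A\<close> cancels, which reduces the middle factor to the
    scalar estimate for Rayleigh quotients.\<close>
  have "B u - B v = (rayleigh A v - rayleigh A u) *\<^sub>R mat 1"
    by (simp add: B_def scaleR_diff_left)
  then have Bd: "spectral_norm (B u - B v) \<le> 2 * N * d"
    using spectral_norm_scaled_identity[where 'n = 'n, of "rayleigh A v - rayleigh A u"]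
      rayleigh_diff_le[OF assms, of A]
    by (simp add: N_def d_def abs_minus_commute)
  \<comment> \<open>Telescoping: u is replaced by v in one factor at a time. Each of the three terms
    is bounded by 8 N d, whence the constant 24.\<close>
  have "newton_J A u - newton_J A v =
      (P u - P v) ** B u ** P u + (P v ** (B u - B v) ** P u + P v ** B v ** (P u - P v))"
    by (simp add: newton_J_def P_def B_def matrix_diff_ldistrib matrix_diff_rdistrib)
  moreover have "spectral_norm ((P u - P v) ** B u ** P u) \<le> 2 * d * (2 * N) * 2"
    by (intro spectral_norm_mult_le P B)
  moreover have "spectral_norm (P v ** (B u - B v) ** P u) \<le> 2 * (2 * N * d) * 2"
    by (intro spectral_norm_mult_le P Bd)
  moreover have "spectral_norm (P v ** B v ** (P u - P v)) \<le> 2 * (2 * N) * (2 * d)"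
    by (intro spectral_norm_mult_le P B)
  ultimately have "spectral_norm (newton_J A u - newton_J A v) \<le>
      2 * d * (2 * N) * 2 + (2 * (2 * N * d) * 2 + 2 * (2 * N) * (2 * d))"
    by (smt (verit) spectral_norm_add)
  then show ?thesis
    by (simp add: N_def d_def mult_ac)
qed

lemma newton_iteration_norm:
  assumes "newton_iteration A u s res"
  shows "norm (u k) = 1"
proof (induction k)
  case 0
  then show ?case
    using assms by (simp add: newton_iteration_def)
next
  case (Suc k)
  have s: "s k \<bullet> u k = 0" and u: "u (Suc k) = (1 / norm (u k + s k)) *\<^sub>R (u k + s k)"
    using assms by (auto simp: newton_iteration_def)
  \<comment> \<open>This excludes the default 1 / 0 = 0, under which the next iterate would be the
    zero vector. Orthogonality does it: the inner product of the sum with \<open>u k\<close> is the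
    squared norm of \<open>u k\<close>.\<close>
  have "u k + s k \<noteq> 0"
  proof
    assume "u k + s k = 0"
    then have "(u k + s k) \<bullet> u k = 0"
      by simp
    then have "u k \<bullet> u k = 0"
      using s by (simp add: inner_add_left)
    then show False
      using Suc by simp
  qed
  then show ?case
    by (simp add: u)
qed

theorem lemma3p5:
  fixes A :: "real^'n^'n" and lam :: "nat \<Rightarrow> real" and v1 :: "real^'n"
    and u s res e :: "nat \<Rightarrow> real^'n" and r :: real
  assumes "transpose A = A" and "pos_definite A"
    and "strict_mono_on {1..CARD('n)} lam"
    and "{l. eigenvalue_of A l} = lam ` {1..CARD('n)}"
    and "norm v1 = 1" and "A *v v1 = lam 1 *\<^sub>R v1"
    and "newton_iteration A u s res"
    and "\<And>k. e k = u k - v1"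
    and "r < 1" and "\<And>k. norm (e (Suc k)) < r * norm (e k)"
  shows "\<exists>\<delta> c1 :: real. \<delta> > 0 \<and>
    (\<forall>k. norm (e k) < \<delta> \<longrightarrow>
      spectral_norm (newton_J A (u (Suc k)) - newton_J A (u k)) \<le> c1 * norm (e k))"
proof (intro exI conjI allI impI)
  \<comment> \<open>Both witnesses are still schematic: this line sets \<delta> = 1, and the last
    \<open>show\<close> sets c1 to 24 \<open>spectral_norm A\<close> times the 2 from the step
    length, which is independent of \<open>k\<close>.\<close>
  show "(1 :: real) > 0"
    by simp
  fix k
  have "r * norm (e k) \<le> norm (e k)"
    using mult_right_mono[of r 1 "norm (e k)"] \<open>r < 1\<close> by simp
  then have "norm (e (Suc k)) \<le> norm (e k)"
    using assms(10)[of k] by linarith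
  \<comment> \<open>The eigenvector \<open>v1\<close> cancels in the difference of two consecutive
    errors.\<close>
  then have "norm (u (Suc k) - u k) \<le> 2 * norm (e k)"
    using norm_triangle_ineq4[of "e (Suc k)" "e k"] by (simp add: assms(8))
  then have "24 * spectral_norm A * norm (u (Suc k) - u k) \<le> 24 * spectral_norm A * (2 * norm (e k))"
    by (intro mult_left_mono) (auto simp: spectral_norm_nonneg)
  then show "spectral_norm (newton_J A (u (Suc k)) - newton_J A (u k)) \<le>
      (48 * spectral_norm A) * norm (e k)"
    using newton_J_lipschitz[of "u (Suc k)" "u k" A] newton_iteration_norm[OF assms(7)] by simp
qed

end
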